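(* Let $\Gamma$ be a non-singular open arc of a real algebraic curve in the plane, with Schwarz function $S$ and inverse $\widetilde S$, and let $n$ be a chosen continuous unit normal field along $\Gamma$. Let $\Omega$ be a simply connected domain containing $\Gamma$ on which $S$ is defined, holomorphic and injective with nowhere vanishing derivative, with $S(\Omega)=\Omega^*:=\{\bar z: z\in\Omega\}$. Let $\varphi$ be a function on $\Gamma$ that continues holomorphically into $\mathbb{C}^2$ near $\Gamma$. Let $u$ be a harmonic function in $\Omega$ with $u=\varphi$ on $\Gamma$, and write its complexification as $u(z,\zeta)=u_1(z)+u_2(\zeta)$, with $u_1$ holomorphic in $\Omega$ and $u_2$ holomorphic in $\Omega^*$. Fix $z_0\in\Gamma$, $\zeta_0=\bar z_0$, and an arbitrary constant $v(z_0,\zeta_0)$. Then the function $$v(z,\zeta)=v(z_0,\zeta_0)+i\int_z^{z_0}u_1(\tau)\sqrt{S'(\tau)}\,d\tau-i\int_\zeta^{\zeta_0}u_2(\xi)\sqrt{\widetilde S'(\xi)}\,d\xi ,$$ where the integrals are taken along paths in $\Omega$ and $\Omega^*$ respectively, is a solution to the Neumann problem: $v$ is harmonic in $\Omega$ (that is, $z\mapsto v(z,\bar z)$ is harmonic in $\Omega$) and $\frac{\partial v}{\partial n}=\varphi$ on $\Gamma$.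
   Context: Points of $\mathbb{R}^2$ are identified with $z=x+iy\in\mathbb{C}$. Functions are complexified via $z=x+iy$, $\zeta=x-iy$, regarded as independent complex variables; the real plane corresponds to $\zeta=\bar z$. On a simply connected domain $\Omega$ every harmonic function has the form $u(z,\zeta)=u_1(z)+u_2(\zeta)$ as in the claim. If $\Gamma=\{f(x,y)=0\}$ with $\operatorname{grad} f\neq 0$ on $\Gamma$, the complexified curve $f\bigl(\frac{z+\zeta}{2},\frac{z-\zeta}{2i}\bigr)=0$ can be solved near $\Gamma$ as $\zeta=S(z)$ or $z=\widetilde S(\zeta)$; $S$ is the Schwarz function of $\Gamma$, i.e. the holomorphic function near $\Gamma$ with $S(z)=\bar z$ on $\Gamma$, and $\widetilde S=S^{-1}$. The branches of the square roots are the holomorphic ones on $\Omega$ and $\Omega^*$ fixed by: $\frac{i}{\sqrt{S'(z)}}=n(z)$ for $z\in\Gamma$ (where the unit normal $n(z)$ is regarded as a complex number of modulus one), and $\sqrt{\widetilde S'(S(z))}\,\sqrt{S'(z)}=1$ for $z\in\Omega$. With this choice the normal derivative on $\Gamma$ of a harmonic function $v=v_1(z)+v_2(\zeta)$ is $\frac{\partial v}{\partial n}=\frac{i}{\sqrt{S'(z)}}\bigl(v_1'(z)-v_2'(\zeta)S'(z)\bigr)$ at $\zeta=\bar z$. *)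

theory Defs
  imports "HOL-Complex_Analysis.Complex_Analysis"
begin

text \<open>Real polynomials in two variables are elements of \<open>\<real>[x][y]\<close>: the outer indeterminate
  is \<open>y\<close>, the inner one is \<open>x\<close>. Points of the plane are complex numbers.\<close>

definition poly2 :: "real poly poly \<Rightarrow> real \<Rightarrow> real \<Rightarrow> real" where
  "poly2 f x y = poly (poly f [:y:]) x"

definition plane_grad :: "(real \<Rightarrow> real \<Rightarrow> real) \<Rightarrow> complex \<Rightarrow> complex" where
  "plane_grad f z =
     Complex (deriv (\<lambda>x. f x (Im z)) (Re z)) (deriv (\<lambda>y. f (Re z) y) (Im z))"

definition nonsingular_open_arc :: "real poly poly \<Rightarrow> complex set \<Rightarrow> bool" where
  "nonsingular_open_arc f \<Gamma> \<longleftrightarrow>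
     \<Gamma> homeomorphic {0<..<1::real} \<and>
     (\<forall>z\<in>\<Gamma>. poly2 f (Re z) (Im z) = 0 \<and> plane_grad (poly2 f) z \<noteq> 0)"

text \<open>At a non-singular point the normal line of \<open>{f = 0}\<close> is spanned by the gradient of \<open>f\<close>.\<close>

definition unit_normal_field :: "real poly poly \<Rightarrow> complex set \<Rightarrow> (complex \<Rightarrow> complex) \<Rightarrow> bool" where
  "unit_normal_field f \<Gamma> n \<longleftrightarrow>
     continuous_on \<Gamma> n \<and>
     (\<forall>z\<in>\<Gamma>. norm (n z) = 1 \<and> (\<exists>c::real. n z = c *\<^sub>R plane_grad (poly2 f) z))"

definition schwarz_function_on :: "complex set \<Rightarrow> complex set \<Rightarrow> (complex \<Rightarrow> complex) \<Rightarrow> bool" where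
  "schwarz_function_on \<Omega> \<Gamma> S \<longleftrightarrow> S holomorphic_on \<Omega> \<and> (\<forall>z\<in>\<Gamma>. S z = cnj z)"

text \<open>\<open>q\<close> and \<open>r\<close> are the branches of the square roots of \<open>S'\<close> on \<open>\<Omega>\<close> and of the derivative of
  the inverse of \<open>S\<close> on \<open>S ` \<Omega>\<close>, normalised by the normal field \<open>n\<close>.\<close>

definition schwarz_sqrt_branches ::
  "complex set \<Rightarrow> complex set \<Rightarrow> (complex \<Rightarrow> complex) \<Rightarrow> (complex \<Rightarrow> complex) \<Rightarrow>
   (complex \<Rightarrow> complex) \<Rightarrow> (complex \<Rightarrow> complex) \<Rightarrow> bool" where
  "schwarz_sqrt_branches \<Omega> \<Gamma> S n q r \<longleftrightarrow>
     q holomorphic_on \<Omega> \<and> (\<forall>z\<in>\<Omega>. (q z)\<^sup>2 = deriv S z) \<and>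
     r holomorphic_on (S ` \<Omega>) \<and> (\<forall>\<zeta>\<in>S ` \<Omega>. (r \<zeta>)\<^sup>2 = deriv (inv_into \<Omega> S) \<zeta>) \<and>
     (\<forall>z\<in>\<Gamma>. \<i> / q z = n z) \<and>
     (\<forall>z\<in>\<Omega>. r (S z) * q z = 1)"

definition holomorphic2_on :: "(complex \<times> complex \<Rightarrow> complex) \<Rightarrow> (complex \<times> complex) set \<Rightarrow> bool" where
  "holomorphic2_on \<Phi> W \<longleftrightarrow>
     open W \<and> (\<forall>p\<in>W. \<exists>a b. (\<Phi> has_derivative (\<lambda>h. a * fst h + b * snd h)) (at p))"

text \<open>The real plane sits in \<open>\<complex>\<^sup>2\<close> as \<open>{(z, \<zeta>). \<zeta> = cnj z}\<close>.\<close>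

definition continues_holomorphically :: "(complex \<Rightarrow> complex) \<Rightarrow> complex set \<Rightarrow> bool" where
  "continues_holomorphically \<phi> \<Gamma> \<longleftrightarrow>
     (\<exists>\<Phi> W. holomorphic2_on \<Phi> W \<and> (\<forall>z\<in>\<Gamma>. (z, cnj z) \<in> W \<and> \<Phi> (z, cnj z) = \<phi> z))"

text \<open>A twice continuously differentiable function with vanishing Laplacian; \<open>ux\<close>, \<open>uy\<close>, \<open>uxx\<close>,
  \<open>uxy\<close>, \<open>uyx\<close>, \<open>uyy\<close> are its partial derivatives. A complex-valued function is harmonic iff its
  real and imaginary parts are.\<close>

definition harmonic_on :: "(complex \<Rightarrow> complex) \<Rightarrow> complex set \<Rightarrow> bool" where
  "harmonic_on u A \<longleftrightarrow> open A \<and>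
     (\<exists>ux uy uxx uxy uyx uyy.
        (\<forall>z\<in>A. (u has_derivative (\<lambda>h. Re h *\<^sub>R ux z + Im h *\<^sub>R uy z)) (at z) \<and>
               (ux has_derivative (\<lambda>h. Re h *\<^sub>R uxx z + Im h *\<^sub>R uxy z)) (at z) \<and>
               (uy has_derivative (\<lambda>h. Re h *\<^sub>R uyx z + Im h *\<^sub>R uyy z)) (at z) \<and>
               uxx z + uyy z = 0) \<and>
        continuous_on A uxx \<and> continuous_on A uxy \<and>
        continuous_on A uyx \<and> continuous_on A uyy)"

definition has_normal_derivative ::
  "(complex \<Rightarrow> complex) \<Rightarrow> (complex \<Rightarrow> complex) \<Rightarrow> complex \<Rightarrow> complex \<Rightarrow> bool" where
  "has_normal_derivative w n d z \<longleftrightarrow>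
     ((\<lambda>t::real. w (z + t *\<^sub>R n z)) has_vector_derivative d) (at 0)"

definition path_in_from_to :: "complex set \<Rightarrow> complex \<Rightarrow> complex \<Rightarrow> (real \<Rightarrow> complex) \<Rightarrow> bool" where
  "path_in_from_to A a b g \<longleftrightarrow>
     valid_path g \<and> path_image g \<subseteq> A \<and> pathstart g = a \<and> pathfinish g = b"

end

theory Submission
  imports Defs
begin

text \<open>Both integrands have primitives on the simply connected domains \<open>\<Omega>\<close> and \<open>cnj ` \<Omega>\<close>, so
  \<open>v\<close> splits as a function holomorphic in \<open>z\<close> plus one holomorphic in \<open>\<zeta>\<close>, with derivatives
  \<open>-\<i> u1 q\<close> and \<open>\<i> u2 r\<close>. On \<open>\<Gamma>\<close> we have \<open>n = \<i> / q\<close>, \<open>cnj n = 1 / n = -\<i> q\<close> and \<open>r = 1 / q\<close>,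
  so differentiating in the direction \<open>n\<close> gives \<open>u1 + u2 = \<phi>\<close>.\<close>

text \<open>Conjugation is real-linear, hence its own derivative, and the chain rule applies to
  \<open>G\<close>. The sum is only real differentiable; \<open>a\<close> and \<open>b\<close> are
  its Wirtinger derivatives with respect to \<open>z\<close> and \<open>cnj z\<close>.\<close>

lemma has_derivative_holomorphic_plus_antiholomorphic:
  fixes F G :: "complex \<Rightarrow> complex"
  assumes "(F has_field_derivative a) (at z)" "(G has_field_derivative b) (at (cnj z))"
  shows "((\<lambda>z. F z + G (cnj z)) has_derivative (\<lambda>h. a * h + b * cnj h)) (at z)"
proof -
  have "((\<lambda>z. G (cnj z)) has_derivative (\<lambda>h. b * cnj h)) (at z)"
    using has_derivative_compose[OF bounded_linear_imp_has_derivative[OF bounded_linear_cnj]]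
      assms(2) unfolding has_field_derivative_def by blast
  with assms(1) show ?thesis
    unfolding has_field_derivative_def by (rule has_derivative_add)
qed

lemma open_cnj_image: "open A \<Longrightarrow> open (cnj ` A)"
  by (rule open_bijective_linear_image_eq[THEN iffD2]) 
    (auto simp: bounded_linear.linear[OF bounded_linear_cnj] bij_def inj_def surj_def intro: exI[of _ "cnj _"])

lemma simply_connected_cnj_image: "simply_connected A \<Longrightarrow> simply_connected (cnj ` A)"
  by (rule homeomorphic_simply_connected[OF linear_homeomorphic_image])
    (auto simp: bounded_linear.linear[OF bounded_linear_cnj] inj_def)

text \<open>The partial derivatives \<open>F' + G'\<close> in x and \<open>\<i> (F' - G')\<close> in
  y are again sums of a holomorphic and an antiholomorphic function, so the same rule differentiates
  them. Two steps in y produce the factor \<open>\<i> * \<i> = -1\<close> on both summands, which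
  cancels the second derivative in x.\<close>

lemma harmonic_on_holomorphic_plus_antiholomorphic:
  assumes "open A" and F: "F holomorphic_on A" and G: "G holomorphic_on (cnj ` A)"
  shows "harmonic_on (\<lambda>z. F z + G (cnj z)) A"
proof -
  note B = open_cnj_image[OF \<open>open A\<close>]
  note F1 = holomorphic_deriv[OF F \<open>open A\<close>] and G1 = holomorphic_deriv[OF G B]
  note F2 = holomorphic_deriv[OF F1 \<open>open A\<close>] and G2 = holomorphic_deriv[OF G1 B]
  \<comment> \<open>The coefficients of \<open>Re h\<close> and \<open>Im h\<close> come from
    \<open>h = Re h + \<i> * Im h\<close> and \<open>cnj h = Re h - \<i> * Im h\<close>. The factors
    \<open>\<kappa>\<close>, \<open>\<mu>\<close> let one statement serve for the function and both
    of its partial derivatives: \<open>1, 1\<close> for the function and the x-derivative,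
    \<open>\<i>, -\<i>\<close> for the y-derivative.\<close>
  have D: "((\<lambda>z. \<kappa> * P z + \<mu> * Q (cnj z)) has_derivative
      (\<lambda>h. Re h *\<^sub>R (\<kappa> * deriv P z + \<mu> * deriv Q (cnj z)) +
           Im h *\<^sub>R (\<i> * (\<kappa> * deriv P z - \<mu> * deriv Q (cnj z))))) (at z)"
    if "P holomorphic_on A" "Q holomorphic_on (cnj ` A)" "z \<in> A" for P Q \<kappa> \<mu> z
  proof -
    have "((\<lambda>z. \<kappa> * P z) has_field_derivative \<kappa> * deriv P z) (at z)"
      "((\<lambda>z. \<mu> * Q z) has_field_derivative \<mu> * deriv Q (cnj z)) (at (cnj z))"
      using that \<open>open A\<close> B by (auto intro!: DERIV_cmult holomorphic_derivI)
    from has_derivative_holomorphic_plus_antiholomorphic[OF this]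
    show ?thesis
      by (rule has_derivative_eq_rhs) (auto simp: fun_eq_iff complex_eq_iff algebra_simps)
  qed
  have contG: "continuous_on A (\<lambda>z. deriv (deriv G) (cnj z))"
    by (rule continuous_on_compose2[OF holomorphic_on_imp_continuous_on[OF G2]])
      (auto intro: continuous_intros)
  note contF = holomorphic_on_imp_continuous_on[OF F2]
  show ?thesis
    unfolding harmonic_on_def
  proof (intro conjI exI ballI)
    fix z assume z: "z \<in> A"
    show "((\<lambda>z. F z + G (cnj z)) has_derivative
       (\<lambda>h. Re h *\<^sub>R (deriv F z + deriv G (cnj z)) +
            Im h *\<^sub>R (\<i> * deriv F z + (-\<i>) * deriv G (cnj z)))) (at z)"
      using D[OF F G z, of 1 1] by (simp add: algebra_simps)
    show "((\<lambda>z. deriv F z + deriv G (cnj z)) has_derivative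
       (\<lambda>h. Re h *\<^sub>R (deriv (deriv F) z + deriv (deriv G) (cnj z)) +
            Im h *\<^sub>R (\<i> * (deriv (deriv F) z - deriv (deriv G) (cnj z))))) (at z)"
      using D[OF F1 G1 z, of 1 1] by simp
    show "((\<lambda>z. \<i> * deriv F z + (-\<i>) * deriv G (cnj z)) has_derivative
       (\<lambda>h. Re h *\<^sub>R (\<i> * deriv (deriv F) z + (-\<i>) * deriv (deriv G) (cnj z)) +
            Im h *\<^sub>R (\<i> * (\<i> * deriv (deriv F) z - (-\<i>) * deriv (deriv G) (cnj z))))) (at z)"
      by (rule D[OF F1 G1 z])
  qed (use \<open>open A\<close> in \<open>auto simp: algebra_simps intro!: continuous_intros contF contG\<close>)
qed

text \<open>A global primitive makes the integral depend on the end points only, so a function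
  defined by integrals along arbitrarily chosen paths can be differentiated in the starting
  point.\<close>

lemma contour_integral_simply_connected_primitive:
  assumes "open A" "simply_connected A" "g holomorphic_on A"
  obtains H where "\<And>z. z \<in> A \<Longrightarrow> (H has_field_derivative g z) (at z)"
    and "\<And>a b p. path_in_from_to A a b p \<Longrightarrow> contour_integral p g = H b - H a"
proof -
  obtain H where H: "\<And>z. z \<in> A \<Longrightarrow> (H has_field_derivative g z) (at z)"
    using simply_connected_eq_global_primitive[OF \<open>open A\<close>] assms(2,3) by blast
  moreover have "contour_integral p g = H b - H a" if "path_in_from_to A a b p" for a b p
    using that contour_integral_unique[OF contour_integral_primitive[of A H g p]]
      has_field_derivative_at_within[OF H]
    unfolding path_in_from_to_def by simp
  ultimately show ?thesis by (rule that)
qed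

text \<open>The function itself enters \<open>harmonic_on\<close> only through its first derivative,
  which on an open set depends only on the values there; the partial derivatives of \<open>u\<close>
  therefore serve for \<open>w\<close>.\<close>

lemma harmonic_on_cong:
  assumes "harmonic_on u A" "\<And>z. z \<in> A \<Longrightarrow> w z = u z"
  shows "harmonic_on w A"
proof -
  have "(w has_derivative D) (at z)" if "open A" "z \<in> A" "(u has_derivative D) (at z)" for D z
    using has_derivative_transform_within_open[OF that(3,1,2)] assms(2) by simp
  with assms(1) show ?thesis
    unfolding harmonic_on_def
    by (elim conjE exE, intro conjI exI ballI) (assumption | blast)+
qed

theorem theorem5:
  fixes f :: "real poly poly"
    and \<Gamma> \<Omega> :: "complex set"
    and S n q r \<phi> u u1 u2 :: "complex \<Rightarrow> complex"
    and v :: "complex \<Rightarrow> complex \<Rightarrow> complex"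
    and z0 c :: complex
    and \<alpha> \<beta> :: "complex \<Rightarrow> real \<Rightarrow> complex"
  assumes arc: "nonsingular_open_arc f \<Gamma>"
    and normal: "unit_normal_field f \<Gamma> n"
    and domain: "open \<Omega>" "connected \<Omega>" "simply_connected \<Omega>" "\<Gamma> \<subseteq> \<Omega>"
    and schwarz: "schwarz_function_on \<Omega> \<Gamma> S" "inj_on S \<Omega>" "\<forall>z\<in>\<Omega>. deriv S z \<noteq> 0"
      "S ` \<Omega> = cnj ` \<Omega>"
    and branches: "schwarz_sqrt_branches \<Omega> \<Gamma> S n q r"
    and phi: "continues_holomorphically \<phi> \<Gamma>"
    and u: "harmonic_on u \<Omega>" "\<forall>z\<in>\<Gamma>. u z = \<phi> z"
    and u_split: "u1 holomorphic_on \<Omega>" "u2 holomorphic_on (cnj ` \<Omega>)"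
      "\<forall>z\<in>\<Omega>. u z = u1 z + u2 (cnj z)"
    and z0: "z0 \<in> \<Gamma>"
    and paths: "\<forall>z\<in>\<Omega>. path_in_from_to \<Omega> z z0 (\<alpha> z)"
      "\<forall>\<zeta>\<in>cnj ` \<Omega>. path_in_from_to (cnj ` \<Omega>) \<zeta> (cnj z0) (\<beta> \<zeta>)"
    and v: "\<forall>z\<in>\<Omega>. \<forall>\<zeta>\<in>cnj ` \<Omega>.
      v z \<zeta> = c + \<i> * contour_integral (\<alpha> z) (\<lambda>\<tau>. u1 \<tau> * q \<tau>)
                - \<i> * contour_integral (\<beta> \<zeta>) (\<lambda>\<xi>. u2 \<xi> * r \<xi>)"
  shows "harmonic_on (\<lambda>z. v z (cnj z)) \<Omega> \<and>
    (\<forall>z\<in>\<Gamma>. has_normal_derivative (\<lambda>z. v z (cnj z)) n (\<phi> z) z)"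
proof -
  define B where "B = cnj ` \<Omega>"
  have opB: "open B" and scB: "simply_connected B"
    unfolding B_def using domain open_cnj_image simply_connected_cnj_image by auto
  have q: "q holomorphic_on \<Omega>" and r: "r holomorphic_on B"
    and nq: "\<And>z. z \<in> \<Gamma> \<Longrightarrow> \<i> / q z = n z" and rq: "\<And>z. z \<in> \<Omega> \<Longrightarrow> r (S z) * q z = 1"
    using branches schwarz(4) unfolding schwarz_sqrt_branches_def B_def by auto
  obtain F where F: "\<And>z. z \<in> \<Omega> \<Longrightarrow> (F has_field_derivative u1 z * q z) (at z)"
    and Fint: "\<And>a b p. path_in_from_to \<Omega> a b p \<Longrightarrow>
      contour_integral p (\<lambda>\<tau>. u1 \<tau> * q \<tau>) = F b - F a"
    using contour_integral_simply_connected_primitive[OF domain(1,3) holomorphic_on_mult[OF u_split(1) q]]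
    by blast
  obtain G where G: "\<And>z. z \<in> B \<Longrightarrow> (G has_field_derivative u2 z * r z) (at z)"
    and Gint: "\<And>a b p. path_in_from_to B a b p \<Longrightarrow>
      contour_integral p (\<lambda>\<xi>. u2 \<xi> * r \<xi>) = G b - G a"
    using contour_integral_simply_connected_primitive[OF opB scB holomorphic_on_mult]
      u_split(2) r unfolding B_def by blast
  \<comment> \<open>The paths end at the base points, so the variable enters the primitives with a
    minus sign. The constant \<open>c\<close> is put into the holomorphic part.\<close>
  define v1 where "v1 z = c + \<i> * (F z0 - F z)" for z
  define v2 where "v2 \<zeta> = - \<i> * (G (cnj z0) - G \<zeta>)" for \<zeta>
  have v_eq: "v z (cnj z) = v1 z + v2 (cnj z)" if "z \<in> \<Omega>" for z
    using that v paths Fint Gint unfolding v1_def v2_def B_def by auto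
  have v1: "(v1 has_field_derivative - \<i> * (u1 z * q z)) (at z)" if "z \<in> \<Omega>" for z
    unfolding v1_def by (rule derivative_eq_intros F that refl | simp)+
  have v2: "(v2 has_field_derivative \<i> * (u2 z * r z)) (at z)" if "z \<in> B" for z
    unfolding v2_def by (rule derivative_eq_intros G that refl | simp)+
  have "harmonic_on (\<lambda>z. v1 z + v2 (cnj z)) \<Omega>"
    using v1 v2 domain(1) opB unfolding B_def
    by (intro harmonic_on_holomorphic_plus_antiholomorphic) (auto simp: holomorphic_on_open)
  then have "harmonic_on (\<lambda>z. v z (cnj z)) \<Omega>"
    by (rule harmonic_on_cong) (simp add: v_eq)
  moreover have "has_normal_derivative (\<lambda>z. v z (cnj z)) n (\<phi> z) z" if z: "z \<in> \<Gamma>" for z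
  proof -
    have zO: "z \<in> \<Omega>" "cnj z \<in> B" using z domain(4) by (auto simp: B_def)
    have rq1: "r (cnj z) * q z = 1"
      \<comment> \<open>On \<Gamma> the Schwarz function satisfies \<open>S z = cnj z\<close>, which
        turns the normalisation of \<open>r\<close> at \<open>S z\<close> into one at
        \<open>cnj z\<close>.\<close>
      using rq[OF zO(1)] schwarz(1) z by (simp add: schwarz_function_on_def)
    then have q0: "q z \<noteq> 0" by auto
    have "n z * cnj (n z) = 1"
      using normal z by (simp add: unit_normal_field_def complex_norm_square[symmetric])
    moreover have "n z * q z = \<i>"
      using nq[OF z, symmetric] q0 by simp
    \<comment> \<open>As \<open>n z\<close> has modulus one, its conjugate is its inverse
      \<open>q z / \<i>\<close>.\<close>
    ultimately have cn: "cnj (n z) = - \<i> * q z"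
      by (metis complex_i_mult_minus mult.assoc mult.commute mult.right_neutral mult_minus_left minus_minus)
    have dir: "- \<i> * (u1 z * q z) * n z + \<i> * (u2 (cnj z) * r (cnj z)) * cnj (n z) = \<phi> z"
    proof -
      have "- \<i> * (u1 z * q z) * n z = u1 z"
        using nq[OF z, symmetric] q0 by (simp add: mult.commute)
      moreover have "\<i> * (u2 (cnj z) * r (cnj z)) * cnj (n z) = u2 (cnj z)"
        using rq1 unfolding cn by (simp add: algebra_simps)
      ultimately show ?thesis
        using u(2) u_split(3) z zO(1) by metis
    qed
    have "((\<lambda>w. v1 w + v2 (cnj w)) has_derivative
        (\<lambda>h. - \<i> * (u1 z * q z) * h + \<i> * (u2 (cnj z) * r (cnj z)) * cnj h)) (at z)"
      by (intro has_derivative_holomorphic_plus_antiholomorphic v1 v2 zO)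
    then have "((\<lambda>w. v w (cnj w)) has_derivative
        (\<lambda>h. - \<i> * (u1 z * q z) * h + \<i> * (u2 (cnj z) * r (cnj z)) * cnj h)) (at z)"
      by (rule has_derivative_transform_within_open[OF _ domain(1) zO(1)]) (simp add: v_eq)
    \<comment> \<open>The base point is written as the value of the line
      \<open>z + t *\<^sub>R n z\<close> at \<open>t = 0\<close>, as the chain rule
      requires.\<close>
    then have "((\<lambda>w. v w (cnj w)) has_derivative
        (\<lambda>h. - \<i> * (u1 z * q z) * h + \<i> * (u2 (cnj z) * r (cnj z)) * cnj h)) (at (z + 0 *\<^sub>R n z))"
      by simp
    moreover have "((\<lambda>t::real. z + t *\<^sub>R n z) has_derivative (\<lambda>t. t *\<^sub>R n z)) (at 0)"
      by (auto intro!: derivative_eq_intros)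
    ultimately have "((\<lambda>t::real. v (z + t *\<^sub>R n z) (cnj (z + t *\<^sub>R n z))) has_derivative
        (\<lambda>t. - \<i> * (u1 z * q z) * (t *\<^sub>R n z) +
             \<i> * (u2 (cnj z) * r (cnj z)) * cnj (t *\<^sub>R n z))) (at 0)"
      by (rule has_derivative_compose[rotated])
    \<comment> \<open>Conjugation commutes with the real factor \<open>t\<close>, so the linear map
      is \<open>t\<close> times the left-hand side of \<open>dir\<close>.\<close>
    then show ?thesis
      unfolding has_normal_derivative_def has_vector_derivative_def
      by (rule has_derivative_eq_rhs)
        (simp add: dir[symmetric] fun_eq_iff scaleR_conv_of_real algebra_simps)
  qed
  ultimately show ?thesis by blast
qed

end
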